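(* Let $H=(V,E,\omega)$ be a finite weighted hypergraph and let $K>0$. Assume that $\inf_{x\neq y}\underline{\kappa}(x,y)\geq K$, the infimum being over all pairs of distinct vertices $x,y\in V$. Then $\mathrm{Diam}\,V\leq 2/K$. Assume moreover that $\mathrm{Diam}\,V=2/K$. Then there exists a pair of points $p,q\in V$ with $d(p,q)=\mathrm{Diam}\,V$ such that every point $v\in V$ lies on a geodesic path connecting $p$ and $q$. Moreover, if $x,y\in V$ are distinct and lie on the same geodesic path connecting $p$ to $q$, then $\underline{\kappa}(x,y)=\overline{\kappa}(x,y)=K$.
   Context: A finite weighted hypergraph $H=(V,E,\omega)$ consists of a finite vertex set $V$, a set $E\subset 2^V$ of (nonempty) hyperedges, and a weight function $\omega:E\to\mathbb{R}_{>0}$, $e\mapsto\omega_e$. Write $x\sim y$ if $x,y\in V$ belong to a common hyperedge. The distance is $$d(x,y):=\min\{n : \text{there are } x=x_0,x_1,\dots,x_n=y \text{ in } V \text{ with } x_i\sim x_{i+1} \text{ for } 0\le i\le n-1\},$$ with $d(x,x)=0$. The hypergraph is connected, i.e. $d$ is finite, and every vertex lies in some hyperedge. A geodesic path from $x$ to $y$ is a sequence $x=x_0,\dots,x_n=y$ with $x_i\sim x_{i+1}$ and $n=d(x,y)$. $\mathrm{Diam}\,V:=\max_{x,y\in V}d(x,y)$. The weighted degree of $x\in V$ is $d_x:=\sum_{e\ni x}\omega_e>0$, and $D$ is the diagonal matrix with entries $D_{x,x}=d_x$. Functions $f:V\to\mathbb{R}$ are identified with column vectors in $\mathbb{R}^V$.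 The inner product on $\mathbb{R}^V$ is $\langle f,g\rangle:=\sum_{x\in V}f(x)g(x)d_x^{-1}$. For $v\in V$, $\delta_v\in\mathbb{R}^V$ is $\delta_v(u)=1$ if $u=v$ and $0$ otherwise. For $e\in E$, the base polytope is $B_e:=\mathrm{Conv}\{\delta_u-\delta_v : u,v\in e\}\subset\mathbb{R}^V$. The Laplacian is the multivalued operator on $\mathbb{R}^V$ $$\mathcal{L}f:=\Big\{\sum_{e\in E}\omega_e\,\big(\mathsf{b}_e^{T}(D^{-1}f)\big)\,\mathsf{b}_e \;:\; \mathsf{b}_e\in\operatorname{argmax}_{\mathsf{b}\in B_e}\mathsf{b}^{T}(D^{-1}f)\ \text{for each } e\in E\Big\}.$$ It is a maximal monotone operator on $(\mathbb{R}^V,\langle\cdot,\cdot\rangle)$, so for each $\lambda>0$ the resolvent $J_\lambda:=(I+\lambda\mathcal{L})^{-1}:\mathbb{R}^V\to\mathbb{R}^V$ is well defined and single-valued. A function $f\in\mathbb{R}^V$ is weighted $1$-Lipschitz if $\langle f,\delta_x-\delta_y\rangle\le d(x,y)$ for all $x,y\in V$; the set of these is $\mathrm{Lip}^1_\omega(V)$. For $\lambda>0$ and $x,y\in V$ the $\lambda$-nonlinear Kantorovich difference is $$\mathsf{KD}_\lambda(x,y):=\sup\{\langle J_\lambda f,\delta_x-\delta_y\rangle : f\in\mathrm{Lip}^1_\omega(V)\}.$$ For $x\ne y$ set $\kappa_\lambda(x,y):=1-\mathsf{KD}_\lambda(x,y)/d(x,y)$, and define the upper and lower coarse Ricci curvatures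 $$\overline{\kappa}(x,y):=\limsup_{\lambda\to+0}\frac{\kappa_\lambda(x,y)}{\lambda},\qquad \underline{\kappa}(x,y):=\liminf_{\lambda\to+0}\frac{\kappa_\lambda(x,y)}{\lambda}.$$ *)

theory Defs
  imports "HOL-Analysis.Analysis"
begin

text \<open>
  The vertex set V is the (nonempty, finite) type \<open>'v\<close>, so that functions on V are vectors in
  \<open>real ^ 'v\<close>; a hypergraph is given by its set \<open>E\<close> of hyperedges and a weight function \<open>w\<close>,
  of which only the values on \<open>E\<close> matter.
\<close>

definition adj :: "'v set set \<Rightarrow> 'v \<Rightarrow> 'v \<Rightarrow> bool" where
  "adj E x y \<longleftrightarrow> (\<exists>e\<in>E. x \<in> e \<and> y \<in> e)"

text \<open>A path with n steps is the list of its n + 1 vertices.\<close>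

definition path_between :: "'v set set \<Rightarrow> 'v \<Rightarrow> 'v \<Rightarrow> 'v list \<Rightarrow> bool" where
  "path_between E x y xs \<longleftrightarrow> xs \<noteq> [] \<and> hd xs = x \<and> last xs = y \<and> successively (adj E) xs"

definition hdist :: "'v set set \<Rightarrow> 'v \<Rightarrow> 'v \<Rightarrow> nat" where
  "hdist E x y = (LEAST n. \<exists>xs. path_between E x y xs \<and> length xs = n + 1)"

definition geodesic_between :: "'v set set \<Rightarrow> 'v \<Rightarrow> 'v \<Rightarrow> 'v list \<Rightarrow> bool" where
  "geodesic_between E x y xs \<longleftrightarrow> path_between E x y xs \<and> length xs = hdist E x y + 1"

definition hdiam :: "'v::finite set set \<Rightarrow> nat" where
  "hdiam E = Max {hdist E x y | x y. True}"

locale weighted_hypergraph =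
  fixes E :: "'v::finite set set" and w :: "'v set \<Rightarrow> real"
  assumes edges_nonempty: "e \<in> E \<Longrightarrow> e \<noteq> {}"
    and weight_pos: "e \<in> E \<Longrightarrow> w e > 0"
    and vertex_covered: "\<exists>e\<in>E. x \<in> e"
    and hconnected: "\<exists>xs. path_between E x y xs"

definition wdegree :: "'v::finite set set \<Rightarrow> ('v set \<Rightarrow> real) \<Rightarrow> 'v \<Rightarrow> real" where
  "wdegree E w x = (\<Sum>e\<in>{e \<in> E. x \<in> e}. w e)"

text \<open>\<open>Dinv E w f\<close> is the vector $D^{-1} f$ for the diagonal degree matrix $D$.\<close>

definition Dinv :: "'v::finite set set \<Rightarrow> ('v set \<Rightarrow> real) \<Rightarrow> real ^ 'v \<Rightarrow> real ^ 'v" where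
  "Dinv E w f = (\<chi> x. f $ x / wdegree E w x)"

definition winner :: "'v::finite set set \<Rightarrow> ('v set \<Rightarrow> real) \<Rightarrow> real ^ 'v \<Rightarrow> real ^ 'v \<Rightarrow> real" where
  "winner E w f g = (\<Sum>x\<in>UNIV. f $ x * g $ x / wdegree E w x)"

definition delta :: "'v::finite \<Rightarrow> real ^ 'v" where
  "delta v = axis v 1"

definition base_polytope :: "'v::finite set \<Rightarrow> (real ^ 'v) set" where
  "base_polytope e = convex hull {delta u - delta v | u v. u \<in> e \<and> v \<in> e}"

text \<open>The multivalued Laplacian. Here \<open>\<bullet>\<close> is the unweighted inner product $b^T g$.\<close>

definition laplacian :: "'v::finite set set \<Rightarrow> ('v set \<Rightarrow> real) \<Rightarrow> real ^ 'v \<Rightarrow> (real ^ 'v) set" where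
  "laplacian E w f =
     {(\<Sum>e\<in>E. (w e * (b e \<bullet> Dinv E w f)) *\<^sub>R b e) | b.
        \<forall>e\<in>E. is_arg_max (\<lambda>c. c \<bullet> Dinv E w f) (\<lambda>c. c \<in> base_polytope e) (b e)}"

text \<open>
  \<open>resolvent E w l f\<close> is the value at f of the single-valued operator
  $(I + \lambda \mathcal{L})^{-1}$, i.e. the unique g with $f \in g + \lambda \mathcal{L} g$.
\<close>

definition resolvent ::
    "'v::finite set set \<Rightarrow> ('v set \<Rightarrow> real) \<Rightarrow> real \<Rightarrow> real ^ 'v \<Rightarrow> real ^ 'v" where
  "resolvent E w l f = (THE g. \<exists>h\<in>laplacian E w g. f = g + l *\<^sub>R h)"

definition wLip1 :: "'v::finite set set \<Rightarrow> ('v set \<Rightarrow> real) \<Rightarrow> (real ^ 'v) set" where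
  "wLip1 E w = {f. \<forall>x y. winner E w f (delta x - delta y) \<le> real (hdist E x y)}"

text \<open>
  Suprema, infima and the limits superior and inferior are taken in the extended reals, so that
  no boundedness has to be presupposed.
\<close>

definition KD :: "'v::finite set set \<Rightarrow> ('v set \<Rightarrow> real) \<Rightarrow> real \<Rightarrow> 'v \<Rightarrow> 'v \<Rightarrow> ereal" where
  "KD E w l x y = (SUP f\<in>wLip1 E w. ereal (winner E w (resolvent E w l f) (delta x - delta y)))"

text \<open>The curvatures below are meaningful only for distinct \<open>x\<close> and \<open>y\<close>.\<close>

definition kappa :: "'v::finite set set \<Rightarrow> ('v set \<Rightarrow> real) \<Rightarrow> real \<Rightarrow> 'v \<Rightarrow> 'v \<Rightarrow> ereal" where
  "kappa E w l x y = 1 - KD E w l x y / ereal (real (hdist E x y))"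

definition upper_curvature :: "'v::finite set set \<Rightarrow> ('v set \<Rightarrow> real) \<Rightarrow> 'v \<Rightarrow> 'v \<Rightarrow> ereal" where
  "upper_curvature E w x y = Limsup (at_right 0) (\<lambda>l. kappa E w l x y / ereal l)"

definition lower_curvature :: "'v::finite set set \<Rightarrow> ('v set \<Rightarrow> real) \<Rightarrow> 'v \<Rightarrow> 'v \<Rightarrow> ereal" where
  "lower_curvature E w x y = Liminf (at_right 0) (\<lambda>l. kappa E w l x y / ereal l)"

end

theory Submission
  imports Defs
begin

text \<open>
  Pass from a vector \<open>f\<close> to the function \<open>\<phi> = Dinv E w f\<close>, so that \<open>f\<close> is weighted 1-Lipschitz iff
  \<open>\<phi> x - \<phi> y \<le> hdist E x y\<close> for all \<open>x\<close>, \<open>y\<close>. For such \<open>f\<close> and small \<open>\<lambda> > 0\<close> let \<open>r\<close> be the decay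
  rate, i.e. the difference quotient \<open>(\<phi> - Dinv E w (J\<^sub>\<lambda> f)) / \<lambda>\<close>. It equals \<open>Dinv E w h\<close> for some \<open>h\<close>
  in the Laplacian of \<open>J\<^sub>\<lambda> f\<close>, and three facts about it carry the whole proof.

  \<^item> Conservation (\<open>decay_rate_weighted_sum_eq_0\<close>): the sum of \<open>wdegree E w x * r x\<close> over all \<open>x\<close> is
    zero, because every point of a base polytope has coordinate sum zero.
  \<^item> Speed limit (\<open>eventually_decay_rate_le\<close>): \<open>\<bar>r x\<bar> \<le> 1 + o(1)\<close>. Each edge at \<open>x\<close> contributes at
    most its weight times the oscillation of the resolvent on it; this oscillation is at most
    \<open>1 + o(1)\<close> because the resolvent is close to \<open>f\<close>.
  \<^item> Curvature (\<open>eventually_decay_rate_diff_ge\<close>): if \<open>\<phi> x - \<phi> y = hdist E x y\<close>, then \<open>f\<close> competes in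
    the supremum defining the Kantorovich difference, so that a lower curvature bound \<open>K\<close> gives
    \<open>r x - r y \<ge> K * hdist E x y - o(1)\<close>.

  For \<open>\<phi> = hdist E _ q\<close> the last two facts at the pair \<open>(p, q)\<close> give \<open>K * hdist E p q \<le> 2\<close>, which is
  the diameter bound.

  Let now \<open>K * hdist E p q = 2\<close>. Denote by \<open>r\<^sub>q\<close> the decay rate for \<open>\<phi> = hdist E _ q\<close> and by \<open>r\<^sub>p\<close> the
  one for \<open>\<phi> = - hdist E _ p\<close>. The pairs \<open>(v, q)\<close> and \<open>(p, v)\<close> yield
  \<open>r\<^sub>q v - r\<^sub>p v \<ge> K * (hdist E p v + hdist E v q - hdist E p q) - o(1)\<close>. The bracket is nonnegative,
  while the weighted sum of the left side over \<open>v\<close> vanishes by conservation. Hence every bracket is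
  zero, i.e. every \<open>v\<close> lies on a geodesic (\<open>hdist_add_eq_if_extremal\<close>). Finally, if a geodesic passes
  through \<open>p\<close>, \<open>x\<close>, \<open>y\<close>, \<open>q\<close> in this order, then the total drop \<open>r\<^sub>q p - r\<^sub>q q \<le> 2 + o(1)\<close> splits into
  three drops; the outer two are at least \<open>K\<close> times their lengths up to \<open>o(1)\<close>, which leaves at most
  \<open>K * hdist E x y + o(1)\<close> for the middle one (\<open>upper_curvature_le_if_extremal\<close>).

  All this presupposes that the resolvent exists. Solving \<open>f \<in> g + \<lambda> \<L> g\<close> amounts to a
  least-squares problem over nonnegative coefficients, that is, to a projection onto a finitely
  generated cone (\<open>finite_cone_projection\<close>, \<open>resolvent_equation_solvable\<close>).
\<close>

section \<open>The combinatorial distance\<close>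

lemma adj_sym: "adj E x y \<longleftrightarrow> adj E y x"
  by (auto simp: adj_def)

lemma path_between_rev: "path_between E x y xs \<Longrightarrow> path_between E y x (rev xs)"
  by (auto simp: path_between_def hd_rev last_rev adj_sym[of E])

lemma path_between_join:
  assumes "path_between E x y xs" "path_between E y z ys"
  shows "path_between E x z (xs @ tl ys)"
proof (cases "tl ys = []")
  case True
  then have "ys = [y]"
    using assms(2) by (cases ys) (auto simp: path_between_def)
  then show ?thesis
    using assms by (auto simp: path_between_def)
next
  case False
  then obtain u us where ys: "ys = y # u # us"
    using assms(2) by (cases ys; cases "tl ys") (auto simp: path_between_def)
  then show ?thesis
    using assms by (auto simp: path_between_def successively_append_iff)
qed

lemma hdist_le_length:
  assumes "path_between E x y xs"
  shows "hdist E x y \<le> length xs - 1"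
  unfolding hdist_def
  by (rule Least_le, rule exI[of _ xs]) (use assms in \<open>auto simp: path_between_def Suc_leI\<close>)

lemma hdist_sym: "hdist E x y = hdist E y x"
proof -
  have "(\<exists>xs. path_between E x y xs \<and> length xs = n + 1) \<longleftrightarrow>
        (\<exists>xs. path_between E y x xs \<and> length xs = n + 1)" for n
    by (metis length_rev path_between_rev)
  then show ?thesis
    by (simp add: hdist_def)
qed

lemma hdiam_attained: "\<exists>p q. hdist E p q = hdiam E"
proof -
  have eq: "{hdist E x y | x y. True} = (\<lambda>(x, y). hdist E x y) ` UNIV"
    by auto
  have "hdiam E \<in> {hdist E x y | x y. True}"
    unfolding hdiam_def by (rule Max_in) (unfold eq, simp_all)
  then obtain p q where "hdiam E = hdist E p q"
    by blast
  then show ?thesis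
    by metis
qed

lemma path_between_take_drop:
  assumes "path_between E p q xs" "i < length xs"
  shows "path_between E p (xs ! i) (take (Suc i) xs)" "path_between E (xs ! i) q (drop i xs)"
proof -
  have "successively (adj E) (take i xs @ drop i xs)" "successively (adj E) (take (Suc i) xs @ drop (Suc i) xs)"
    using assms by (simp_all add: path_between_def)
  then have "successively (adj E) (take (Suc i) xs)" "successively (adj E) (drop i xs)"
    unfolding successively_append_iff by blast+
  moreover have "last (take (Suc i) xs) = xs ! i"
    using assms(2) by (simp add: take_Suc_conv_app_nth)
  ultimately show "path_between E p (xs ! i) (take (Suc i) xs)" "path_between E (xs ! i) q (drop i xs)"
    using assms by (auto simp: path_between_def hd_drop_conv_nth)
qed

lemma hdist_le_index_diff:
  assumes "path_between E p q xs" "i \<le> j" "j < length xs"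
  shows "hdist E (xs ! i) (xs ! j) \<le> j - i"
proof -
  have "path_between E p (xs ! j) (take (Suc j) xs)"
    by (rule path_between_take_drop) (use assms in auto)
  then have "path_between E (take (Suc j) xs ! i) (xs ! j) (drop i (take (Suc j) xs))"
    by (rule path_between_take_drop) (use assms in auto)
  then show ?thesis
    using hdist_le_length assms by fastforce
qed

context weighted_hypergraph
begin

lemma geodesic_exists: "\<exists>xs. geodesic_between E x y xs"
proof -
  obtain xs where "path_between E x y xs"
    using hconnected by blast
  then have "\<exists>n xs. path_between E x y xs \<and> length xs = n + 1"
    by (intro exI[of _ "length xs - 1"] exI[of _ xs]) (auto simp: path_between_def Suc_leI)
  then have "\<exists>xs. path_between E x y xs \<and> length xs = hdist E x y + 1"
    unfolding hdist_def by (rule LeastI_ex)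
  then show ?thesis
    by (simp add: geodesic_between_def)
qed

lemma geodesic_join:
  assumes "geodesic_between E x y xs" "geodesic_between E y z ys"
  shows "path_between E x z (xs @ tl ys)" "length (xs @ tl ys) = hdist E x y + hdist E y z + 1"
  using assms path_between_join[of E x y xs z ys] by (auto simp: geodesic_between_def)

lemma hdist_triangle: "hdist E x z \<le> hdist E x y + hdist E y z"
proof -
  obtain xs ys where "geodesic_between E x y xs" "geodesic_between E y z ys"
    using geodesic_exists by blast
  from geodesic_join[OF this] show ?thesis
    using hdist_le_length by fastforce
qed

lemma hdist_self [simp]: "hdist E x x = 0"
  using hdist_le_length[of E x x "[x]"] by (simp add: path_between_def)

lemma hdist_eq_0_iff [simp]: "hdist E x y = 0 \<longleftrightarrow> x = y"
proof
  assume "hdist E x y = 0"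
  with geodesic_exists[of x y] obtain xs where "path_between E x y xs" "length xs = 1"
    by (auto simp: geodesic_between_def)
  then show "x = y"
    by (cases xs) (auto simp: path_between_def)
qed simp

lemma hdist_pos_iff [simp]: "hdist E x y > 0 \<longleftrightarrow> x \<noteq> y"
  using hdist_eq_0_iff[of x y] by linarith

lemma hdist_edge_le_1: "e \<in> E \<Longrightarrow> u \<in> e \<Longrightarrow> v \<in> e \<Longrightarrow> hdist E u v \<le> 1"
  using hdist_le_length[of E u v "[u, v]"] by (auto simp: path_between_def adj_def)

lemma on_geodesic_if_hdist_add:
  assumes "hdist E p v + hdist E v q = hdist E p q"
  shows "\<exists>xs. geodesic_between E p q xs \<and> v \<in> set xs"
proof -
  obtain xs ys where g: "geodesic_between E p v xs" "geodesic_between E v q ys"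
    using geodesic_exists by blast
  then have "xs \<noteq> []" "last xs = v"
    by (auto simp: geodesic_between_def path_between_def)
  then have "v \<in> set xs"
    using last_in_set by blast
  then show ?thesis
    using geodesic_join[OF g] assms
    by (intro exI[of _ "xs @ tl ys"]) (auto simp: geodesic_between_def)
qed

text \<open>
  The three segments cut out by two points of a geodesic are no longer than the corresponding index
  differences, which add up to the length of the geodesic; by the triangle inequality none of them
  can be shorter. The two alternatives are the two orders in which the points may be visited.
\<close>

lemma geodesic_points_hdist_add:
  assumes "geodesic_between E p q xs" "x \<in> set xs" "y \<in> set xs"
  shows "hdist E p x + hdist E x y + hdist E y q = hdist E p q \<or>
         hdist E p y + hdist E y x + hdist E x q = hdist E p q"
proof -
  have ordered: "hdist E p (xs ! i) + hdist E (xs ! i) (xs ! j) + hdist E (xs ! j) q = hdist E p q"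
    if "i \<le> j" "j < length xs" for i j
  proof -
    have path: "path_between E p q xs" and len: "length xs = hdist E p q + 1"
      using assms(1) by (auto simp: geodesic_between_def)
    have "xs ! 0 = p" "xs ! (length xs - 1) = q"
      using path by (auto simp: path_between_def hd_conv_nth last_conv_nth)
    then have "hdist E p (xs ! i) \<le> i" "hdist E (xs ! i) (xs ! j) \<le> j - i"
      "hdist E (xs ! j) q \<le> length xs - 1 - j"
      using that hdist_le_index_diff[OF path, of 0 i] hdist_le_index_diff[OF path, of i j]
        hdist_le_index_diff[OF path, of j "length xs - 1"] by auto
    then show ?thesis
      using hdist_triangle[of p "xs ! j" "xs ! i"] hdist_triangle[of p q "xs ! j"] len that by linarith
  qed
  obtain i j where "i < length xs" "j < length xs" "x = xs ! i" "y = xs ! j"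
    using assms by (auto simp: in_set_conv_nth)
  then show ?thesis
    using ordered[of i j] ordered[of j i] by (cases "i \<le> j") auto
qed

end

section \<open>Base polytopes and the Laplacian\<close>

lemma inner_delta_diff [simp]:
  "(delta u - delta v) \<bullet> g = g $ u - g $ v" "g \<bullet> (delta u - delta v) = g $ u - g $ v"
  by (simp_all add: delta_def inner_diff_left inner_diff_right inner_axis inner_axis')

text \<open>
  A linear functional on a polytope is maximal at a vertex. Applied to the functionals given by
  coordinate vectors and by constant vectors, this one bound yields the next two lemmas.
\<close>

lemma base_polytope_inner_le:
  assumes "b \<in> base_polytope e" "\<And>u v. u \<in> e \<Longrightarrow> v \<in> e \<Longrightarrow> g $ u - g $ v \<le> c"
  shows "b \<bullet> g \<le> c"
proof -
  have "base_polytope e \<subseteq> {b. g \<bullet> b \<le> c}"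
    unfolding base_polytope_def
    by (rule hull_minimal) (use assms(2) in \<open>auto simp: convex_halfspace_le\<close>)
  then show ?thesis
    using assms(1) by (auto simp: inner_commute)
qed

lemma base_polytope_sum_eq_0:
  assumes "b \<in> base_polytope e"
  shows "(\<Sum>x\<in>UNIV. b $ x) = 0"
proof -
  have "b \<bullet> vec 1 \<le> 0" "b \<bullet> vec (-1) \<le> 0"
    by (rule base_polytope_inner_le[OF assms]; simp)+
  then show ?thesis
    by (simp add: inner_vec_def sum_negf)
qed

lemma base_polytope_abs_le:
  assumes "b \<in> base_polytope e"
  shows "\<bar>b $ x\<bar> \<le> (if x \<in> e then 1 else 0)"
proof -
  have "b \<bullet> axis x 1 \<le> (if x \<in> e then 1 else 0)" "b \<bullet> axis x (-1) \<le> (if x \<in> e then 1 else 0)"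
    by (rule base_polytope_inner_le[OF assms]; auto simp: axis_def)+
  then show ?thesis
    by (simp add: inner_axis)
qed

lemma delta_diff_in_base_polytope: "u \<in> e \<Longrightarrow> v \<in> e \<Longrightarrow> delta u - delta v \<in> base_polytope e"
  unfolding base_polytope_def by (rule hull_inc) auto

context weighted_hypergraph
begin

lemma wdegree_pos: "wdegree E w x > 0"
proof -
  obtain e where "e \<in> E" "x \<in> e"
    using vertex_covered by blast
  then show ?thesis
    unfolding wdegree_def by (intro sum_pos) (auto simp: weight_pos)
qed

lemma zero_in_base_polytope: "e \<in> E \<Longrightarrow> 0 \<in> base_polytope e"
  using edges_nonempty delta_diff_in_base_polytope by fastforce

lemma winner_eq_inner: "winner E w f g = Dinv E w f \<bullet> g"
  by (simp add: winner_def Dinv_def inner_vec_def)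

lemma winner_delta_diff:
  "winner E w f (delta x - delta y) = Dinv E w f $ x - Dinv E w f $ y"
  by (simp add: winner_eq_inner)

lemma Dinv_add: "Dinv E w (f + g) = Dinv E w f + Dinv E w g"
  and Dinv_scaleR: "Dinv E w (c *\<^sub>R f) = c *\<^sub>R Dinv E w f"
  by (simp_all add: Dinv_def vec_eq_iff add_divide_distrib)

text \<open>
  The last property, nonnegativity of the maximum, comes from \<open>0\<close> lying in every base polytope.
\<close>

lemma laplacianE:
  assumes "h \<in> laplacian E w g"
  obtains b where "h = (\<Sum>e\<in>E. (w e * (b e \<bullet> Dinv E w g)) *\<^sub>R b e)"
    "\<And>e. e \<in> E \<Longrightarrow> b e \<in> base_polytope e"
    "\<And>e c. e \<in> E \<Longrightarrow> c \<in> base_polytope e \<Longrightarrow> c \<bullet> Dinv E w g \<le> b e \<bullet> Dinv E w g"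
    "\<And>e. e \<in> E \<Longrightarrow> 0 \<le> b e \<bullet> Dinv E w g"
proof -
  from assms obtain b where b: "h = (\<Sum>e\<in>E. (w e * (b e \<bullet> Dinv E w g)) *\<^sub>R b e)"
    "\<forall>e\<in>E. is_arg_max (\<lambda>c. c \<bullet> Dinv E w g) (\<lambda>c. c \<in> base_polytope e) (b e)"
    by (auto simp: laplacian_def)
  show thesis
    by (rule that[of b]) (use b zero_in_base_polytope in \<open>force simp: is_arg_max_linorder\<close>)+
qed

lemma laplacian_sum_eq_0:
  assumes "h \<in> laplacian E w g"
  shows "(\<Sum>x\<in>UNIV. h $ x) = 0"
proof -
  obtain b where b: "h = (\<Sum>e\<in>E. (w e * (b e \<bullet> Dinv E w g)) *\<^sub>R b e)"
    "\<And>e. e \<in> E \<Longrightarrow> b e \<in> base_polytope e"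
    "\<And>e c. e \<in> E \<Longrightarrow> c \<in> base_polytope e \<Longrightarrow> c \<bullet> Dinv E w g \<le> b e \<bullet> Dinv E w g"
    "\<And>e. e \<in> E \<Longrightarrow> 0 \<le> b e \<bullet> Dinv E w g"
    by (rule laplacianE[OF assms]) (rule that)
  have "(\<Sum>x\<in>UNIV. h $ x) = (\<Sum>e\<in>E. (w e * (b e \<bullet> Dinv E w g)) * (\<Sum>x\<in>UNIV. b e $ x))"
    unfolding b(1) sum_component sum_distrib_left by (subst sum.swap) simp
  also have "\<dots> = 0"
    by (simp add: base_polytope_sum_eq_0[OF b(2)])
  finally show ?thesis .
qed

text \<open>
  Only the edges containing \<open>x\<close> contribute, each at most its weight times its oscillation, since
  the coordinates of a point of a base polytope lie in \<open>[-1, 1]\<close>.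
\<close>

lemma laplacian_abs_le:
  assumes "h \<in> laplacian E w g"
    and osc: "\<And>e u v. e \<in> E \<Longrightarrow> u \<in> e \<Longrightarrow> v \<in> e \<Longrightarrow> Dinv E w g $ u - Dinv E w g $ v \<le> M"
  shows "\<bar>h $ x\<bar> \<le> wdegree E w x * M"
proof -
  obtain b where b: "h = (\<Sum>e\<in>E. (w e * (b e \<bullet> Dinv E w g)) *\<^sub>R b e)"
    "\<And>e. e \<in> E \<Longrightarrow> b e \<in> base_polytope e"
    "\<And>e c. e \<in> E \<Longrightarrow> c \<in> base_polytope e \<Longrightarrow> c \<bullet> Dinv E w g \<le> b e \<bullet> Dinv E w g"
    "\<And>e. e \<in> E \<Longrightarrow> 0 \<le> b e \<bullet> Dinv E w g"
    by (rule laplacianE[OF assms(1)]) (rule that)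
  have "\<bar>h $ x\<bar> \<le> (\<Sum>e\<in>E. \<bar>w e * (b e \<bullet> Dinv E w g) * b e $ x\<bar>)"
    unfolding b(1) sum_component vector_scaleR_component real_scaleR_def by (rule sum_abs)
  also have "\<dots> \<le> (\<Sum>e\<in>E. if x \<in> e then w e * M else 0)"
  proof (rule sum_mono)
    fix e assume e: "e \<in> E"
    have m: "b e \<bullet> Dinv E w g \<le> M"
      by (rule base_polytope_inner_le[OF b(2)[OF e] osc[OF e]])
    have "\<bar>w e * (b e \<bullet> Dinv E w g) * b e $ x\<bar> = w e * (b e \<bullet> Dinv E w g) * \<bar>b e $ x\<bar>"
      using weight_pos[OF e] b(4)[OF e] by (simp add: abs_mult)
    also have "\<dots> \<le> w e * M * (if x \<in> e then 1 else 0)"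
      using weight_pos[OF e] b(4)[OF e] m base_polytope_abs_le[OF b(2)[OF e]]
      by (intro mult_mono) auto
    finally show "\<bar>w e * (b e \<bullet> Dinv E w g) * b e $ x\<bar> \<le> (if x \<in> e then w e * M else 0)"
      by (simp split: if_splits)
  qed
  also have "\<dots> = wdegree E w x * M"
    unfolding wdegree_def sum_distrib_right by (rule sum.inter_filter[symmetric]) simp
  finally show ?thesis .
qed

lemma laplacian_accretive:
  assumes "h \<in> laplacian E w g"
  shows "Dinv E w g \<bullet> h \<ge> 0"
proof -
  obtain b where b: "h = (\<Sum>e\<in>E. (w e * (b e \<bullet> Dinv E w g)) *\<^sub>R b e)"
    "\<And>e. e \<in> E \<Longrightarrow> b e \<in> base_polytope e"
    "\<And>e c. e \<in> E \<Longrightarrow> c \<in> base_polytope e \<Longrightarrow> c \<bullet> Dinv E w g \<le> b e \<bullet> Dinv E w g"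
    "\<And>e. e \<in> E \<Longrightarrow> 0 \<le> b e \<bullet> Dinv E w g"
    by (rule laplacianE[OF assms]) (rule that)
  have "Dinv E w g \<bullet> h = (\<Sum>e\<in>E. w e * (b e \<bullet> Dinv E w g)\<^sup>2)"
    unfolding b(1) inner_sum_right by (simp add: power2_eq_square inner_commute mult.assoc)
  also have "\<dots> \<ge> 0"
    by (intro sum_nonneg mult_nonneg_nonneg) (auto simp: weight_pos less_imp_le)
  finally show ?thesis .
qed

text \<open>
  With \<open>m\<close>, \<open>m'\<close> the maxima on an edge for \<open>g\<close> and \<open>g'\<close>, maximality bounds the mixed products by
  \<open>m m'\<close>, so that the edge contributes at least \<open>(m - m')\<^sup>2\<close> times its weight.
\<close>

lemma laplacian_monotone:
  assumes "h \<in> laplacian E w g" "h' \<in> laplacian E w g'"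
  shows "(Dinv E w g - Dinv E w g') \<bullet> (h - h') \<ge> 0"
proof -
  obtain b where b: "h = (\<Sum>e\<in>E. (w e * (b e \<bullet> Dinv E w g)) *\<^sub>R b e)"
    "\<And>e. e \<in> E \<Longrightarrow> b e \<in> base_polytope e"
    "\<And>e c. e \<in> E \<Longrightarrow> c \<in> base_polytope e \<Longrightarrow> c \<bullet> Dinv E w g \<le> b e \<bullet> Dinv E w g"
    "\<And>e. e \<in> E \<Longrightarrow> 0 \<le> b e \<bullet> Dinv E w g"
    by (rule laplacianE[OF assms(1)]) (rule that)
  obtain b' where b': "h' = (\<Sum>e\<in>E. (w e * (b' e \<bullet> Dinv E w g')) *\<^sub>R b' e)"
    "\<And>e. e \<in> E \<Longrightarrow> b' e \<in> base_polytope e"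
    "\<And>e c. e \<in> E \<Longrightarrow> c \<in> base_polytope e \<Longrightarrow> c \<bullet> Dinv E w g' \<le> b' e \<bullet> Dinv E w g'"
    "\<And>e. e \<in> E \<Longrightarrow> 0 \<le> b' e \<bullet> Dinv E w g'"
    by (rule laplacianE[OF assms(2)]) (rule that)
  let ?G = "Dinv E w g" and ?G' = "Dinv E w g'"
  have "(?G - ?G') \<bullet> (h - h') =
      (\<Sum>e\<in>E. w e * ((b e \<bullet> ?G) * (b e \<bullet> ?G - b e \<bullet> ?G') - (b' e \<bullet> ?G') * (b' e \<bullet> ?G - b' e \<bullet> ?G')))"
    unfolding b(1) b'(1) inner_diff_right inner_sum_right sum_subtractf[symmetric]
    by (rule sum.cong) (simp_all add: inner_diff_left algebra_simps inner_commute)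
  also have "\<dots> \<ge> 0"
  proof (intro sum_nonneg mult_nonneg_nonneg)
    fix e assume e: "e \<in> E"
    have "(b e \<bullet> ?G) * (b e \<bullet> ?G - b' e \<bullet> ?G') \<le> (b e \<bullet> ?G) * (b e \<bullet> ?G - b e \<bullet> ?G')"
      using b(4)[OF e] b'(3)[OF e b(2)[OF e]] by (intro mult_left_mono) auto
    moreover have "(b' e \<bullet> ?G') * (b' e \<bullet> ?G - b' e \<bullet> ?G') \<le> (b' e \<bullet> ?G') * (b e \<bullet> ?G - b' e \<bullet> ?G')"
      using b'(4)[OF e] b(3)[OF e b'(2)[OF e]] by (intro mult_left_mono) auto
    moreover have "(b e \<bullet> ?G) * (b e \<bullet> ?G - b' e \<bullet> ?G') - (b' e \<bullet> ?G') * (b e \<bullet> ?G - b' e \<bullet> ?G')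
        = (b e \<bullet> ?G - b' e \<bullet> ?G')\<^sup>2"
      by (simp add: power2_eq_square algebra_simps)
    ultimately show "0 \<le> (b e \<bullet> ?G) * (b e \<bullet> ?G - b e \<bullet> ?G') - (b' e \<bullet> ?G') * (b' e \<bullet> ?G - b' e \<bullet> ?G')"
      using zero_le_power2[of "b e \<bullet> ?G - b' e \<bullet> ?G'"] by linarith
    show "0 \<le> w e"
      using weight_pos[OF e] by simp
  qed
  finally show ?thesis .
qed

end

section \<open>The resolvent\<close>

text \<open>
  The complementarity conditions of nonnegative least squares: if \<open>k\<close> is the point closest to \<open>z\<close> of
  the (closed) cone generated by the \<open>g i\<close>, then the residual \<open>z - k\<close> has obtuse angle with every
  generator, and is orthogonal to those that \<open>k\<close> uses.
\<close>

lemma finite_cone_projection: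
  fixes g :: "'i \<Rightarrow> 'a::euclidean_space"
  assumes "finite I"
  obtains a where "\<And>i. 0 \<le> a i"
    "\<And>i. i \<in> I \<Longrightarrow> (z - (\<Sum>j\<in>I. a j *\<^sub>R g j)) \<bullet> g i \<le> 0"
    "\<And>i. i \<in> I \<Longrightarrow> 0 < a i \<Longrightarrow> (z - (\<Sum>j\<in>I. a j *\<^sub>R g j)) \<bullet> g i = 0"
proof -
  let ?comb = "\<lambda>a. \<Sum>j\<in>I. a j *\<^sub>R g j"
  let ?C = "convex_cone hull (g ` I)"
  have comb_in: "?comb a \<in> ?C" if "\<And>i. 0 \<le> a i" for a
  proof -
    have "(\<Sum>j\<in>J. a j *\<^sub>R g j) \<in> ?C" if "finite J" "J \<subseteq> I" for J
      using that
    proof (induction J rule: finite_induct)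
      case empty
      show ?case
        by (simp add: convex_cone_hull_contains_0)
    next
      case (insert j J)
      then have "a j *\<^sub>R g j \<in> ?C"
        using \<open>\<And>i. 0 \<le> a i\<close> by (intro convex_cone_hull_mul hull_inc) auto
      with insert show ?case
        by (auto intro: convex_cone_hull_add)
    qed
    then show ?thesis
      using assms by blast
  qed
  have "?C \<subseteq> {?comb a | a. \<forall>i. 0 \<le> a i}"
  proof (rule hull_minimal)
    show "g ` I \<subseteq> {?comb a | a. \<forall>i. 0 \<le> a i}"
    proof safe
      fix i assume "i \<in> I"
      then have "g i = ?comb (\<lambda>j. if j = i then 1 else 0)"
        using assms by (simp add: if_distrib[of "\<lambda>c. c *\<^sub>R _"] cong: if_cong)
      then show "\<exists>a. g i = ?comb a \<and> (\<forall>i. 0 \<le> a i)"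
        by (intro exI[of _ "\<lambda>j. if j = i then 1 else 0"]) simp
    qed
    show "convex_cone {?comb a | a. \<forall>i. 0 \<le> a i}"
      unfolding convex_cone_iff
    proof (intro conjI ballI allI impI)
      show "0 \<in> {?comb a | a. \<forall>i. 0 \<le> a i}"
        by (auto intro!: exI[of _ "\<lambda>_. 0"])
      fix x y assume "x \<in> {?comb a | a. \<forall>i. 0 \<le> a i}" "y \<in> {?comb a | a. \<forall>i. 0 \<le> a i}"
      then obtain a b where "x = ?comb a" "y = ?comb b" "\<forall>i. 0 \<le> a i" "\<forall>i. 0 \<le> b i"
        by auto
      then show "x + y \<in> {?comb a | a. \<forall>i. 0 \<le> a i}"
        by (auto intro!: exI[of _ "\<lambda>i. a i + b i"] simp: scaleR_add_left sum.distrib)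
    next
      fix x and c :: real assume "x \<in> {?comb a | a. \<forall>i. 0 \<le> a i}" "0 \<le> c"
      then obtain a where "x = ?comb a" "\<forall>i. 0 \<le> a i"
        by auto
      then show "c *\<^sub>R x \<in> {?comb a | a. \<forall>i. 0 \<le> a i}"
        using \<open>0 \<le> c\<close> by (auto intro!: exI[of _ "\<lambda>i. c * a i"] simp: scaleR_sum_right)
    qed
  qed
  moreover have closed: "closed ?C" and convex: "convex ?C"
    using assms by (simp_all add: closed_convex_cone_hull convex_convex_cone_hull)
  then have "closest_point ?C z \<in> ?C"
    by (intro closest_point_in_set) (auto simp: convex_cone_hull_nonempty)
  ultimately obtain a where a: "closest_point ?C z = ?comb a" "\<And>i. 0 \<le> a i"
    by blast
  let ?r = "z - ?comb a"
  have obtuse: "?r \<bullet> (y - ?comb a) \<le> 0" if "y \<in> ?C" for y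
    using closest_point_dot[OF convex closed that, of z] a(1) by simp
  have nonpos: "?r \<bullet> g i \<le> 0" if i: "i \<in> I" for i
    using obtuse[of "?comb a + g i"] i comb_in[of a] a(2)
    by (auto intro: convex_cone_hull_add hull_inc)
  have complementary: "?r \<bullet> g i = 0" if i: "i \<in> I" "0 < a i" for i
  proof -
    \<comment> \<open>Removing the \<open>i\<close>-th summand keeps the point in the cone, so both directions along \<open>g i\<close> are obtuse.\<close>
    let ?a = "\<lambda>j. if j = i then 0 else a j"
    have "?comb ?a \<in> ?C"
      by (rule comb_in) (simp add: a(2))
    moreover have "?comb a = ?comb ?a + a i *\<^sub>R g i"
      using assms i(1)
      by (simp add: sum.remove[OF assms i(1)] sum.remove[OF assms i(1), of "\<lambda>j. a j *\<^sub>R g j"])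
    ultimately have "?r \<bullet> (- (a i *\<^sub>R g i)) \<le> 0"
      using obtuse[of "?comb ?a"] by (simp add: algebra_simps)
    then show ?thesis
      using i nonpos[OF i(1)] by (simp add: zero_le_mult_iff)
  qed
  show thesis
    using that[of a] a(2) nonpos complementary by blast
qed

context weighted_hypergraph
begin

lemma resolvent_equation_unique:
  assumes "l > 0" "h \<in> laplacian E w g" "h' \<in> laplacian E w g'"
    and eq: "g + l *\<^sub>R h = g' + l *\<^sub>R h'"
  shows "g = g'"
proof -
  let ?s = "\<lambda>x. (g $ x - g' $ x)\<^sup>2 / wdegree E w x"
  have nonneg: "?s x \<ge> 0" for x
    using wdegree_pos[of x] by simp
  have diff: "g - g' = - (l *\<^sub>R (h - h'))"
    using eq by (simp add: algebra_simps)
  have "(\<Sum>x\<in>UNIV. ?s x) = (Dinv E w g - Dinv E w g') \<bullet> (g - g')"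
    by (simp add: Dinv_def inner_vec_def power2_eq_square diff_divide_distrib[symmetric])
  also have "\<dots> = - (l * ((Dinv E w g - Dinv E w g') \<bullet> (h - h')))"
    unfolding diff by simp
  also have "\<dots> \<le> 0"
    using laplacian_monotone[OF assms(2,3)] \<open>l > 0\<close> by simp
  finally have "(\<Sum>x\<in>UNIV. ?s x) = 0"
    using sum_nonneg[of UNIV ?s] nonneg by force
  then have "?s x = 0" for x
    using sum_nonneg_eq_0_iff[of UNIV ?s] nonneg by simp
  then show ?thesis
    using wdegree_pos by (simp add: vec_eq_iff) (metis less_irrefl)
qed

text \<open>
  The equation asks for nonnegative flows \<open>a (e, u, v)\<close> along
  \<open>delta u - delta v\<close> whose total is \<open>f - g\<close>. With \<open>T e\<close> the total flow in \<open>e\<close> and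
  \<open>\<psi> = Dinv E w g\<close>, the conditions for \<open>g\<close> to solve it are that \<open>\<psi> u - \<psi> v \<le> T e / (l * w e)\<close> for
  \<open>u, v\<close> in \<open>e\<close>, with equality where the flow is positive. These are the complementarity conditions of
  \<open>finite_cone_projection\<close> for the generators \<open>G (e, u, v)\<close> below: the first component makes their
  inner products produce the term \<open>T e / (l * w e)\<close>, and the factor \<open>r\<close> in the second turns the
  Euclidean inner product into the one weighted by \<open>1 / wdegree E w x\<close>.
\<close>

lemma resolvent_equation_solvable:
  assumes "l > 0"
  shows "\<exists>g. \<exists>h\<in>laplacian E w g. f = g + l *\<^sub>R h"
proof -
  define I where "I = Sigma E (\<lambda>e. e \<times> e)"
  define r :: "'v \<Rightarrow> real" where "r x = 1 / sqrt (wdegree E w x)" for x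
  define c where "c e = 1 / sqrt (l * w e)" for e
  define G :: "'v set \<times> 'v \<times> 'v \<Rightarrow> (real ^ 'v set) \<times> (real ^ 'v)" where
    "G = (\<lambda>(e, u, v). (axis e (c e), \<chi> x. r x * (delta u - delta v) $ x))"
  define z :: "(real ^ 'v set) \<times> (real ^ 'v)" where "z = (0, \<chi> x. r x * f $ x)"
  have [simp]: "finite I" "finite E" "finite e" for e :: "'v set"
    by (simp_all add: I_def)
  obtain a where a: "\<And>i. 0 \<le> a i"
    "\<And>i. i \<in> I \<Longrightarrow> (z - (\<Sum>j\<in>I. a j *\<^sub>R G j)) \<bullet> G i \<le> 0"
    "\<And>i. i \<in> I \<Longrightarrow> 0 < a i \<Longrightarrow> (z - (\<Sum>j\<in>I. a j *\<^sub>R G j)) \<bullet> G i = 0"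
    using finite_cone_projection[OF \<open>finite I\<close>, of z G] by blast
  define T where "T e = (\<Sum>(u, v)\<in>e \<times> e. a (e, u, v))" for e
  define flow where "flow e = (\<Sum>(u, v)\<in>e \<times> e. a (e, u, v) *\<^sub>R (delta u - delta v))" for e
  define g where "g = f - (\<Sum>e\<in>E. flow e)"
  \<comment> \<open>On an edge without flow this is \<open>0\<close>, as division by zero gives zero; there \<open>0\<close> is a maximiser.\<close>
  define b where "b e = (1 / T e) *\<^sub>R flow e" for e
  let ?psi = "Dinv E w g"
  have sum_I: "(\<Sum>i\<in>I. k i) = (\<Sum>e\<in>E. \<Sum>p\<in>e \<times> e. k (e, p))" for k :: "_ \<Rightarrow> real"
    by (simp add: I_def sum.Sigma)
  have T_nonneg: "T e \<ge> 0" for e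
    unfolding T_def by (intro sum_nonneg) (auto simp: a(1))
  have fst_res: "fst (z - (\<Sum>j\<in>I. a j *\<^sub>R G j)) $ e = - c e * T e" if "e \<in> E" for e
  proof -
    have "fst (\<Sum>j\<in>I. a j *\<^sub>R G j) $ e = (\<Sum>e'\<in>E. \<Sum>(u, v)\<in>e' \<times> e'. a (e', u, v) * axis e' (c e') $ e)"
      by (simp add: fst_sum sum_I G_def split_def)
    also have "\<dots> = (\<Sum>e'\<in>E. if e' = e then T e * c e else 0)"
      unfolding T_def sum_distrib_right
      by (rule sum.cong) (auto simp: axis_def split_def)
    finally show ?thesis
      using that by (simp add: z_def)
  qed
  have snd_res: "snd (z - (\<Sum>j\<in>I. a j *\<^sub>R G j)) $ x = r x * g $ x" for x
  proof -
    have "snd (\<Sum>j\<in>I. a j *\<^sub>R G j) $ x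
        = (\<Sum>e\<in>E. \<Sum>(u, v)\<in>e \<times> e. a (e, u, v) * (r x * (delta u - delta v) $ x))"
      by (simp add: snd_sum sum_I G_def split_def)
    also have "\<dots> = r x * (\<Sum>e\<in>E. flow e) $ x"
      unfolding flow_def by (simp add: sum_distrib_left split_def mult_ac)
    finally show ?thesis
      by (simp add: z_def g_def algebra_simps)
  qed
  have r2: "r x * r x * t = t / wdegree E w x" for x t
    using wdegree_pos[of x] by (simp add: r_def)
  have res: "(z - (\<Sum>j\<in>I. a j *\<^sub>R G j)) \<bullet> G (e, u, v) = ?psi $ u - ?psi $ v - T e / (l * w e)"
    if e: "e \<in> E" for e u v
  proof -
    have "(\<chi> x. r x * g $ x) \<bullet> (\<chi> x. r x * (delta u - delta v) $ x) = ?psi \<bullet> (delta u - delta v)"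
      unfolding inner_vec_def Dinv_def by (rule sum.cong) (simp_all add: r2[symmetric] mult_ac)
    moreover have "snd (z - (\<Sum>j\<in>I. a j *\<^sub>R G j)) = (\<chi> x. r x * g $ x)"
      using snd_res by (simp add: vec_eq_iff)
    moreover have "c e * c e = 1 / (l * w e)"
      using weight_pos[OF e] \<open>l > 0\<close> by (simp add: c_def)
    ultimately show ?thesis
      using fst_res[OF e] by (simp add: G_def inner_prod_def inner_axis mult_ac)
  qed
  have osc_le: "?psi $ u - ?psi $ v \<le> T e / (l * w e)" if "e \<in> E" "u \<in> e" "v \<in> e" for e u v
    using a(2)[of "(e, u, v)"] res[of e u v] that by (simp add: I_def)
  have osc_eq: "a (e, u, v) * (?psi $ u - ?psi $ v) = a (e, u, v) * (T e / (l * w e))"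
    if "e \<in> E" "u \<in> e" "v \<in> e" for e u v
    using a(1)[of "(e, u, v)"] a(3)[of "(e, u, v)"] res[of e u v] that
    by (cases "a (e, u, v) = 0") (auto simp: I_def)
  have b_flow: "T e *\<^sub>R b e = flow e" for e
  proof (cases "T e = 0")
    case True
    then have "\<forall>p\<in>e \<times> e. a (e, p) = 0"
      unfolding T_def by (subst (asm) sum_nonneg_eq_0_iff) (auto simp: a(1))
    then have "flow e = 0"
      unfolding flow_def by (intro sum.neutral) auto
    then show ?thesis
      by (simp add: b_def)
  qed (simp add: b_def)
  have b_in: "b e \<in> base_polytope e" if e: "e \<in> E" for e
  proof (cases "T e = 0")
    case True
    then show ?thesis
      using zero_in_base_polytope[OF e] by (simp add: b_def)
  next
    case False
    have "(\<Sum>p\<in>e \<times> e. (a (e, p) / T e) *\<^sub>R (delta (fst p) - delta (snd p))) \<in> base_polytope e"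
    proof (rule convex_sum)
      show "convex (base_polytope e)"
        by (simp add: base_polytope_def)
      show "(\<Sum>p\<in>e \<times> e. a (e, p) / T e) = 1"
        using False by (simp add: sum_divide_distrib[symmetric] T_def)
    qed (use T_nonneg a(1) delta_diff_in_base_polytope in auto)
    then show ?thesis
      by (simp add: b_def flow_def scaleR_sum_right split_def)
  qed
  have b_psi: "b e \<bullet> ?psi = T e / (l * w e)" if e: "e \<in> E" for e
  proof (cases "T e = 0")
    case False
    have "flow e \<bullet> ?psi = (\<Sum>(u, v)\<in>e \<times> e. a (e, u, v) * (?psi $ u - ?psi $ v))"
      by (simp add: flow_def inner_sum_left split_def)
    also have "\<dots> = T e * (T e / (l * w e))"
      unfolding T_def sum_distrib_right using osc_eq[OF e] by (intro sum.cong) (auto simp: T_def)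
    finally show ?thesis
      using False by (simp add: b_def)
  qed (simp add: b_def)
  have b_max: "is_arg_max (\<lambda>c. c \<bullet> ?psi) (\<lambda>c. c \<in> base_polytope e) (b e)" if e: "e \<in> E" for e
    unfolding is_arg_max_linorder b_psi[OF e]
    using b_in[OF e] base_polytope_inner_le[OF _ osc_le[OF e]] by blast
  define h where "h = (\<Sum>e\<in>E. (w e * (b e \<bullet> ?psi)) *\<^sub>R b e)"
  have "h \<in> laplacian E w g"
    unfolding h_def laplacian_def using b_max by blast
  moreover have "l *\<^sub>R h = (\<Sum>e\<in>E. flow e)"
    unfolding h_def scaleR_sum_right
  proof (rule sum.cong)
    fix e assume e: "e \<in> E"
    have "l * (w e * (T e / (l * w e))) = T e"
      using weight_pos[OF e] \<open>l > 0\<close> by simp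
    then show "l *\<^sub>R ((w e * (b e \<bullet> ?psi)) *\<^sub>R b e) = flow e"
      using b_flow[of e] by (simp add: b_psi[OF e])
  qed simp
  ultimately show ?thesis
    by (intro exI[of _ g] bexI[of _ h]) (simp_all add: g_def)
qed

lemma resolvent_equation:
  assumes "l > 0"
  shows "\<exists>h\<in>laplacian E w (resolvent E w l f). f = resolvent E w l f + l *\<^sub>R h"
  unfolding resolvent_def
proof (rule theI')
  show "\<exists>!g. \<exists>h\<in>laplacian E w g. f = g + l *\<^sub>R h"
    using resolvent_equation_solvable[OF assms] resolvent_equation_unique[OF assms] by metis
qed

section \<open>The decay rate of a Lipschitz function under the resolvent\<close>

definition decay_rate :: "real ^ 'v \<Rightarrow> real \<Rightarrow> 'v \<Rightarrow> real" where
  "decay_rate f l x = (Dinv E w f $ x - Dinv E w (resolvent E w l f) $ x) / l"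

lemma decay_rate_in_laplacian:
  assumes "l > 0"
  obtains h where "h \<in> laplacian E w (resolvent E w l f)" "f = resolvent E w l f + l *\<^sub>R h"
    "\<And>x. decay_rate f l x = h $ x / wdegree E w x"
proof -
  obtain h where h: "h \<in> laplacian E w (resolvent E w l f)" "f = resolvent E w l f + l *\<^sub>R h"
    using resolvent_equation[OF assms] by blast
  have "Dinv E w f = Dinv E w (resolvent E w l f) + l *\<^sub>R Dinv E w h"
    by (metis Dinv_add Dinv_scaleR h(2))
  then have "decay_rate f l x = h $ x / wdegree E w x" for x
    using assms by (simp add: decay_rate_def) (simp add: Dinv_def)
  with h show thesis
    using that by blast
qed

lemma decay_rate_weighted_sum_eq_0:
  assumes "l > 0"
  shows "(\<Sum>x\<in>UNIV. wdegree E w x * decay_rate f l x) = 0"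
proof -
  obtain h where h: "h \<in> laplacian E w (resolvent E w l f)" "f = resolvent E w l f + l *\<^sub>R h"
    "\<And>x. decay_rate f l x = h $ x / wdegree E w x"
    by (rule decay_rate_in_laplacian[OF assms]) (rule that)
  have "wdegree E w x * decay_rate f l x = h $ x" for x
    using wdegree_pos[of x] by (simp add: h(3))
  then show ?thesis
    using laplacian_sum_eq_0[OF h(1)] by simp
qed

text \<open>
  Expanding the square of \<open>f = g + l *\<^sub>R h\<close>, the mixed term is nonnegative by \<open>laplacian_accretive\<close>.
\<close>

lemma resolvent_norm_le:
  assumes "l > 0"
  shows "winner E w (resolvent E w l f) (resolvent E w l f) \<le> winner E w f f"
proof -
  let ?g = "resolvent E w l f"
  obtain h where h: "h \<in> laplacian E w (resolvent E w l f)" "f = resolvent E w l f + l *\<^sub>R h"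
    "\<And>x. decay_rate f l x = h $ x / wdegree E w x"
    by (rule decay_rate_in_laplacian[OF assms]) (rule that)
  have "f $ x * f $ x / wdegree E w x = ?g $ x * ?g $ x / wdegree E w x
      + 2 * l * (?g $ x / wdegree E w x * h $ x) + l\<^sup>2 * ((h $ x)\<^sup>2 / wdegree E w x)" for x
    using arg_cong[OF h(2), of "\<lambda>f. f $ x"] wdegree_pos[of x]
    by (simp add: field_simps power2_eq_square)
  then have "winner E w f f = winner E w ?g ?g + 2 * l * (Dinv E w ?g \<bullet> h)
      + l\<^sup>2 * (\<Sum>x\<in>UNIV. (h $ x)\<^sup>2 / wdegree E w x)"
    by (simp add: winner_def inner_vec_def Dinv_def sum.distrib sum_distrib_left)
  moreover have "0 \<le> 2 * l * (Dinv E w ?g \<bullet> h)"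
    using laplacian_accretive[OF h(1)] assms by simp
  moreover have "0 \<le> l\<^sup>2 * (\<Sum>x\<in>UNIV. (h $ x)\<^sup>2 / wdegree E w x)"
    by (intro mult_nonneg_nonneg sum_nonneg divide_nonneg_pos) (auto simp: wdegree_pos)
  ultimately show ?thesis
    by linarith
qed

lemma resolvent_bounded: "\<exists>R\<ge>0. \<forall>l>0. \<forall>x. \<bar>Dinv E w (resolvent E w l f) $ x\<bar> \<le> R"
proof -
  define B where "B x = sqrt (winner E w f f / wdegree E w x)" for x
  have nonneg: "winner E w f f \<ge> 0"
    unfolding winner_def by (intro sum_nonneg divide_nonneg_pos) (auto simp: wdegree_pos)
  have B_nonneg: "B x \<ge> 0" for x
    unfolding B_def using nonneg wdegree_pos[of x] by simp
  have "\<bar>Dinv E w (resolvent E w l f) $ x\<bar> \<le> B x" if "l > 0" for l x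
  proof -
    let ?g = "resolvent E w l f" and ?d = "wdegree E w x"
    have "?g $ x * ?g $ x / ?d \<le> winner E w ?g ?g"
      unfolding winner_def by (rule member_le_sum) (auto simp: wdegree_pos less_imp_le)
    also have "\<dots> \<le> winner E w f f"
      by (rule resolvent_norm_le[OF that])
    finally have "?g $ x * ?g $ x / ?d / ?d \<le> winner E w f f / ?d"
      by (intro divide_right_mono) (auto simp: wdegree_pos less_imp_le)
    then have "(Dinv E w ?g $ x)\<^sup>2 \<le> winner E w f f / ?d"
      by (simp add: Dinv_def power2_eq_square)
    then show ?thesis
      unfolding B_def using real_sqrt_le_mono by fastforce
  qed
  moreover have "B x \<le> (\<Sum>x\<in>UNIV. B x)" for x
    by (rule member_le_sum) (auto simp: B_nonneg)
  ultimately show ?thesis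
    using B_nonneg by (intro exI[of _ "\<Sum>x\<in>UNIV. B x"]) (meson order_trans sum_nonneg)
qed

text \<open>
  A bootstrap. The uniform bound on the resolvent bounds its oscillations crudely, hence also the
  decay rate; so the resolvent differs from \<open>f\<close> by \<open>O(l)\<close>, its oscillations on edges are at most
  \<open>1 + O(l)\<close>, and \<open>laplacian_abs_le\<close> applies once more with this better bound.
\<close>

lemma decay_rate_bound:
  assumes "f \<in> wLip1 E w"
  shows "\<exists>C. \<forall>l>0. \<forall>x. \<bar>decay_rate f l x\<bar> \<le> 1 + C * l"
proof -
  obtain R where R: "R \<ge> 0" "\<And>l x. l > 0 \<Longrightarrow> \<bar>Dinv E w (resolvent E w l f) $ x\<bar> \<le> R"
    using resolvent_bounded by metis
  have bound: "\<bar>decay_rate f l x\<bar> \<le> M" if "l > 0"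
    and osc: "\<And>e u v. e \<in> E \<Longrightarrow> u \<in> e \<Longrightarrow> v \<in> e \<Longrightarrow>
      Dinv E w (resolvent E w l f) $ u - Dinv E w (resolvent E w l f) $ v \<le> M" for l x M
  proof -
    obtain h where h: "h \<in> laplacian E w (resolvent E w l f)" "f = resolvent E w l f + l *\<^sub>R h"
      "\<And>x. decay_rate f l x = h $ x / wdegree E w x"
      by (rule decay_rate_in_laplacian[OF \<open>l > 0\<close>]) (rule that)
    show ?thesis
      using laplacian_abs_le[OF h(1) osc, where x = x] wdegree_pos[of x]
      by (simp add: h(3) abs_divide divide_le_eq mult.commute)
  qed
  have "\<bar>decay_rate f l x\<bar> \<le> 1 + (4 * R) * l" if "l > 0" for l x
  proof (rule bound[OF \<open>l > 0\<close>])
    fix e u v assume e: "e \<in> E" "u \<in> e" "v \<in> e"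
    have crude: "\<bar>decay_rate f l y\<bar> \<le> 2 * R" for y
    proof (rule bound[OF \<open>l > 0\<close>])
      fix u v
      show "Dinv E w (resolvent E w l f) $ u - Dinv E w (resolvent E w l f) $ v \<le> 2 * R"
        using R(2)[OF \<open>l > 0\<close>, of u] R(2)[OF \<open>l > 0\<close>, of v] by linarith
    qed
    have psi: "Dinv E w (resolvent E w l f) $ y = Dinv E w f $ y - l * decay_rate f l y" for y
      using \<open>l > 0\<close> by (simp add: decay_rate_def)
    have "l * \<bar>decay_rate f l y\<bar> \<le> l * (2 * R)" for y
      using crude \<open>l > 0\<close> by (intro mult_left_mono) auto
    then have step: "\<bar>l * decay_rate f l y\<bar> \<le> 2 * R * l" for y
      using \<open>l > 0\<close> by (simp add: abs_mult mult_ac)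
    have "Dinv E w f $ u - Dinv E w f $ v \<le> 1"
      using assms hdist_edge_le_1[OF e] unfolding wLip1_def winner_delta_diff
      by (smt (verit) mem_Collect_eq of_nat_1 of_nat_mono)
    then show "Dinv E w (resolvent E w l f) $ u - Dinv E w (resolvent E w l f) $ v \<le> 1 + (4 * R) * l"
      unfolding psi using step[of u] step[of v] by linarith
  qed
  then show ?thesis
    by blast
qed

lemma eventually_decay_rate_le:
  assumes "f \<in> wLip1 E w" "\<epsilon> > 0"
  shows "\<forall>\<^sub>F l in at_right 0. \<forall>x. \<bar>decay_rate f l x\<bar> \<le> 1 + \<epsilon>"
proof -
  obtain C where C: "\<And>l x. l > 0 \<Longrightarrow> \<bar>decay_rate f l x\<bar> \<le> 1 + C * l"
    using decay_rate_bound[OF assms(1)] by blast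
  have "((\<lambda>l. C * l) \<longlongrightarrow> C * 0) (at_right 0)"
    by (intro tendsto_intros)
  then have "\<forall>\<^sub>F l in at_right 0. C * l < \<epsilon>"
    using assms(2) by (intro order_tendstoD) auto
  moreover have "\<forall>\<^sub>F l in at_right (0::real). l > 0"
    by (rule eventually_at_right_less)
  ultimately show ?thesis
  proof eventually_elim
    case (elim l)
    show ?case
    proof
      fix x
      show "\<bar>decay_rate f l x\<bar> \<le> 1 + \<epsilon>"
        using C[OF elim(2), of x] elim(1) by linarith
    qed
  qed
qed

section \<open>Curvature and decay rates\<close>

text \<open>
  \<open>f\<close> is one of the competitors in the supremum \<open>KD E w l x y\<close>. Tightness at \<open>(x, y)\<close> makes the leading
  terms of \<open>1 - KD E w l x y / hdist E x y\<close> cancel, so that only the decay rates remain.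
\<close>

lemma kappa_div_le:
  assumes "f \<in> wLip1 E w" "l > 0" "x \<noteq> y"
    and tight: "Dinv E w f $ x - Dinv E w f $ y = hdist E x y"
  shows "kappa E w l x y / ereal l \<le> ereal ((decay_rate f l x - decay_rate f l y) / hdist E x y)"
proof -
  let ?d = "real (hdist E x y)" and ?J = "Dinv E w (resolvent E w l f)"
  have d: "?d > 0"
    using assms(3) by simp
  have "ereal (?J $ x - ?J $ y) \<le> KD E w l x y"
    unfolding KD_def winner_delta_diff using assms(1) by (rule SUP_upper)
  then have "kappa E w l x y \<le> 1 - ereal (?J $ x - ?J $ y) / ereal ?d"
    unfolding kappa_def using d by (intro ereal_minus_mono ereal_divide_right_mono) auto
  then have "kappa E w l x y / ereal l \<le> (1 - ereal (?J $ x - ?J $ y) / ereal ?d) / ereal l"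
    using assms(2) by (intro ereal_divide_right_mono) auto
  also have "\<dots> = ereal ((1 - (?J $ x - ?J $ y) / ?d) / l)"
    using d assms(2) by (simp add: one_ereal_def)
  also have "(1 - (?J $ x - ?J $ y) / ?d) / l = (decay_rate f l x - decay_rate f l y) / ?d"
  proof -
    have "1 - (?J $ x - ?J $ y) / ?d = (?d - (?J $ x - ?J $ y)) / ?d"
      using d by (simp add: diff_divide_distrib)
    also have "?d - (?J $ x - ?J $ y) = l * (decay_rate f l x - decay_rate f l y)"
      using assms(2) unfolding tight[symmetric] by (simp add: decay_rate_def diff_divide_distrib[symmetric])
    finally show ?thesis
      using assms(2) by simp
  qed
  finally show ?thesis .
qed

lemma eventually_decay_rate_diff_ge:
  assumes "f \<in> wLip1 E w" "\<epsilon> > 0"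
    and curv: "\<And>x y. x \<noteq> y \<Longrightarrow> lower_curvature E w x y \<ge> ereal K"
    and tight: "Dinv E w f $ x - Dinv E w f $ y = hdist E x y"
  shows "\<forall>\<^sub>F l in at_right 0. K * hdist E x y - \<epsilon> \<le> decay_rate f l x - decay_rate f l y"
proof (cases "x = y")
  case True
  then show ?thesis
    using assms(2) by simp
next
  case False
  let ?d = "real (hdist E x y)"
  have d: "?d > 0"
    using False by simp
  have "ereal (K - \<epsilon> / ?d) < ereal K"
    using d assms(2) by simp
  then have "\<forall>\<^sub>F l in at_right 0. ereal (K - \<epsilon> / ?d) < kappa E w l x y / ereal l"
    using curv[OF False] unfolding lower_curvature_def le_Liminf_iff by blast
  moreover have "\<forall>\<^sub>F l in at_right (0::real). l > 0"
    by (rule eventually_at_right_less)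
  ultimately show ?thesis
  proof eventually_elim
    case (elim l)
    then have "ereal (K - \<epsilon> / ?d) < ereal ((decay_rate f l x - decay_rate f l y) / ?d)"
      using kappa_div_le[OF assms(1) _ False tight] by (meson less_le_trans)
    then show ?case
      using d by (simp add: field_simps)
  qed
qed

text \<open>
  The degree factor is there to cancel against \<open>Dinv\<close>: the potential of this vector is the distance.
\<close>

definition dist_from :: "'v \<Rightarrow> real ^ 'v" where
  "dist_from q = (\<chi> x. wdegree E w x * hdist E x q)"

lemma Dinv_dist_from: "Dinv E w (dist_from q) $ x = hdist E x q"
  using wdegree_pos[of x] by (simp add: Dinv_def dist_from_def)

lemma Dinv_uminus_dist_from: "Dinv E w (- dist_from q) $ x = - real (hdist E x q)"
  using wdegree_pos[of x] by (simp add: Dinv_def dist_from_def)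

lemma dist_from_wLip1: "dist_from q \<in> wLip1 E w" "- dist_from q \<in> wLip1 E w"
proof -
  have "real (hdist E x q) - real (hdist E y q) \<le> hdist E x y" for x y
    using hdist_triangle[of x q y] by linarith
  moreover from this have "real (hdist E y q) - real (hdist E x q) \<le> hdist E x y" for x y
    by (metis hdist_sym)
  ultimately show "dist_from q \<in> wLip1 E w" "- dist_from q \<in> wLip1 E w"
    by (simp_all add: wLip1_def winner_delta_diff Dinv_dist_from Dinv_uminus_dist_from)
qed

text \<open>
  The speed limit at the two end points against the curvature bound, for the distance from \<open>q\<close>.
\<close>

lemma curvature_mult_hdist_le_2:
  assumes "\<And>x y. x \<noteq> y \<Longrightarrow> lower_curvature E w x y \<ge> ereal K"
  shows "K * hdist E p q \<le> 2"
proof (rule field_le_epsilon)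
  fix \<epsilon> :: real assume "\<epsilon> > 0"
  then have "\<epsilon> / 3 > 0"
    by simp
  have "\<forall>\<^sub>F l in at_right 0. K * hdist E p q - \<epsilon> / 3 \<le> decay_rate (dist_from q) l p - decay_rate (dist_from q) l q"
    by (rule eventually_decay_rate_diff_ge[OF dist_from_wLip1(1) \<open>\<epsilon> / 3 > 0\<close> assms])
       (simp_all add: Dinv_dist_from)
  moreover have "\<forall>\<^sub>F l in at_right 0. \<forall>x. \<bar>decay_rate (dist_from q) l x\<bar> \<le> 1 + \<epsilon> / 3"
    by (rule eventually_decay_rate_le[OF dist_from_wLip1(1) \<open>\<epsilon> / 3 > 0\<close>])
  ultimately have "\<forall>\<^sub>F l in at_right (0::real). K * hdist E p q \<le> 2 + \<epsilon>"
  proof eventually_elim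
    case (elim l)
    from elim(2)[rule_format, of p] elim(2)[rule_format, of q] elim(1) show ?case
      by linarith
  qed
  then show "K * hdist E p q \<le> 2 + \<epsilon>"
    by (simp add: eventually_const_iff)
qed

text \<open>
  The excess \<open>S x\<close> below is nonnegative by the triangle inequality, and up to an arbitrarily small
  error it is at most the difference of two decay rates. As the degree-weighted sum of any decay rate
  vanishes, so does that of \<open>S\<close>, and therefore \<open>S\<close> itself.
\<close>

lemma hdist_add_eq_if_extremal:
  assumes K: "K > 0"
    and curv: "\<And>x y. x \<noteq> y \<Longrightarrow> lower_curvature E w x y \<ge> ereal K"
    and extremal: "K * hdist E p q = 2"
  shows "hdist E p v + hdist E v q = hdist E p q"
proof -
  let ?fp = "- dist_from p" and ?fq = "dist_from q"
  define S where "S x = K * (real (hdist E p x) + real (hdist E x q)) - 2" for x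
  define D where "D = (\<Sum>x\<in>UNIV. wdegree E w x)"
  have S_nonneg: "wdegree E w x * S x \<ge> 0" for x
  proof -
    have "K * real (hdist E p q) \<le> K * (real (hdist E p x) + real (hdist E x q))"
      using hdist_triangle[of p q x] K by (intro mult_left_mono) auto
    then show ?thesis
      using extremal wdegree_pos[of x] by (simp add: S_def)
  qed
  have D_pos: "D > 0"
    unfolding D_def by (intro sum_pos) (auto simp: wdegree_pos)
  have "(\<Sum>x\<in>UNIV. wdegree E w x * S x) \<le> 0"
  proof (rule field_le_epsilon)
    fix \<epsilon> :: real assume "\<epsilon> > 0"
    \<comment> \<open>Two curvature estimates and two speed limits each cost one \<open>\<delta>\<close> at every vertex.\<close>
    define \<delta> where "\<delta> = \<epsilon> / (4 * D)"
    have \<delta>: "\<delta> > 0"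
      using \<open>\<epsilon> > 0\<close> D_pos by (simp add: \<delta>_def)
    have "\<forall>\<^sub>F l in at_right 0. \<forall>x\<in>UNIV. K * hdist E p x - \<delta> \<le> decay_rate ?fp l p - decay_rate ?fp l x"
      by (intro eventually_ball_finite ballI eventually_decay_rate_diff_ge[OF dist_from_wLip1(2) \<delta> curv])
         (simp_all add: Dinv_uminus_dist_from hdist_sym)
    moreover have "\<forall>\<^sub>F l in at_right 0. \<forall>x\<in>UNIV. K * hdist E x q - \<delta> \<le> decay_rate ?fq l x - decay_rate ?fq l q"
      by (intro eventually_ball_finite ballI eventually_decay_rate_diff_ge[OF dist_from_wLip1(1) \<delta> curv])
         (simp_all add: Dinv_dist_from)
    moreover have "\<forall>\<^sub>F l in at_right 0. \<forall>x. \<bar>decay_rate ?fp l x\<bar> \<le> 1 + \<delta>"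
      by (rule eventually_decay_rate_le[OF dist_from_wLip1(2) \<delta>])
    moreover have "\<forall>\<^sub>F l in at_right 0. \<forall>x. \<bar>decay_rate ?fq l x\<bar> \<le> 1 + \<delta>"
      by (rule eventually_decay_rate_le[OF dist_from_wLip1(1) \<delta>])
    moreover have "\<forall>\<^sub>F l in at_right (0::real). l > 0"
      by (rule eventually_at_right_less)
    ultimately have "\<forall>\<^sub>F l in at_right (0::real). (\<Sum>x\<in>UNIV. wdegree E w x * S x) \<le> 0 + \<epsilon>"
    proof eventually_elim
      case (elim l)
      have S_le: "S x \<le> decay_rate ?fq l x - decay_rate ?fp l x + 4 * \<delta>" for x
      proof -
        have "K * hdist E p x - \<delta> \<le> decay_rate ?fp l p - decay_rate ?fp l x"
          "K * hdist E x q - \<delta> \<le> decay_rate ?fq l x - decay_rate ?fq l q"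
          using elim(1,2) by auto
        moreover have "\<bar>decay_rate ?fp l p\<bar> \<le> 1 + \<delta>" "\<bar>decay_rate ?fq l q\<bar> \<le> 1 + \<delta>"
          using elim(3,4) by auto
        ultimately show ?thesis
          unfolding S_def distrib_left by linarith
      qed
      have "(\<Sum>x\<in>UNIV. wdegree E w x * S x)
          \<le> (\<Sum>x\<in>UNIV. wdegree E w x * (decay_rate ?fq l x - decay_rate ?fp l x + 4 * \<delta>))"
        using S_le wdegree_pos by (intro sum_mono mult_left_mono) (auto intro: less_imp_le)
      also have "\<dots> = (\<Sum>x\<in>UNIV. wdegree E w x * decay_rate ?fq l x)
          - (\<Sum>x\<in>UNIV. wdegree E w x * decay_rate ?fp l x) + D * (4 * \<delta>)"
        unfolding D_def sum_distrib_right sum_subtractf[symmetric] sum.distrib[symmetric]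
        by (simp add: algebra_simps)
      also have "\<dots> = \<epsilon>"
        using D_pos elim(5) by (simp add: decay_rate_weighted_sum_eq_0 \<delta>_def)
      finally show ?case
        by simp
    qed
    then show "(\<Sum>x\<in>UNIV. wdegree E w x * S x) \<le> 0 + \<epsilon>"
      by (simp add: eventually_const_iff)
  qed
  then have "(\<Sum>x\<in>UNIV. wdegree E w x * S x) = 0"
    using sum_nonneg[of UNIV "\<lambda>x. wdegree E w x * S x"] S_nonneg by force
  then have "wdegree E w v * S v = 0"
    using sum_nonneg_eq_0_iff[of UNIV "\<lambda>x. wdegree E w x * S x"] S_nonneg by simp
  then have "K * (real (hdist E p v) + real (hdist E v q)) = K * real (hdist E p q)"
    using wdegree_pos[of v] extremal by (simp add: S_def)
  then show ?thesis
    using K by (simp flip: of_nat_add)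
qed

text \<open>
  The distance from \<open>q\<close> is tight at all three pairs \<open>(p, x)\<close>, \<open>(x, y)\<close>, \<open>(y, q)\<close>. Its decay rate drops by
  at most about \<open>2 = K * hdist E p q\<close> from \<open>p\<close> to \<open>q\<close>, and the curvature bound forces the two outer
  segments to use up their share of this.
\<close>

lemma upper_curvature_le_if_extremal:
  assumes curv: "\<And>x y. x \<noteq> y \<Longrightarrow> lower_curvature E w x y \<ge> ereal K"
    and extremal: "K * hdist E p q = 2"
    and between: "hdist E p x + hdist E x y + hdist E y q = hdist E p q"
    and "x \<noteq> y"
  shows "upper_curvature E w x y \<le> ereal K"
  unfolding upper_curvature_def Limsup_le_iff
proof (intro allI impI)
  fix c assume c: "ereal K < c"
  let ?f = "dist_from q" and ?d = "real (hdist E x y)"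
  have d: "?d > 0"
    using \<open>x \<noteq> y\<close> by simp
  obtain c' where c': "K < c'" "ereal c' < c"
    using ereal_dense2[OF c] by auto
  \<comment> \<open>Two curvature estimates and two halves from the speed limits add up to \<open>3 * \<epsilon>\<close>, which must be below the gap.\<close>
  define \<epsilon> where "\<epsilon> = (c' - K) * ?d / 4"
  have \<epsilon>: "\<epsilon> > 0"
    using c' d by (simp add: \<epsilon>_def)
  have tight: "hdist E p q = hdist E p x + hdist E x q" "hdist E x q = hdist E x y + hdist E y q"
    using between hdist_triangle[of p q x] hdist_triangle[of x q y] by linarith+
  have "\<forall>\<^sub>F l in at_right 0. K * hdist E p x - \<epsilon> \<le> decay_rate ?f l p - decay_rate ?f l x"
    by (rule eventually_decay_rate_diff_ge[OF dist_from_wLip1(1) \<epsilon> curv])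
       (simp_all add: Dinv_dist_from tight(1))
  moreover have "\<forall>\<^sub>F l in at_right 0. K * hdist E y q - \<epsilon> \<le> decay_rate ?f l y - decay_rate ?f l q"
    by (rule eventually_decay_rate_diff_ge[OF dist_from_wLip1(1) \<epsilon> curv])
       (simp_all add: Dinv_dist_from)
  moreover have "\<forall>\<^sub>F l in at_right 0. \<forall>x. \<bar>decay_rate ?f l x\<bar> \<le> 1 + \<epsilon> / 2"
    using \<epsilon> by (intro eventually_decay_rate_le[OF dist_from_wLip1(1)]) auto
  moreover have "\<forall>\<^sub>F l in at_right (0::real). l > 0"
    by (rule eventually_at_right_less)
  ultimately show "\<forall>\<^sub>F l in at_right 0. kappa E w l x y / ereal l < c"
  proof eventually_elim
    case (elim l)
    have "K * hdist E p x + K * ?d + K * hdist E y q = 2"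
      unfolding extremal[symmetric] between[symmetric] by (simp add: algebra_simps)
    moreover have "\<bar>decay_rate ?f l p\<bar> \<le> 1 + \<epsilon> / 2" "\<bar>decay_rate ?f l q\<bar> \<le> 1 + \<epsilon> / 2"
      using elim(3) by auto
    ultimately have "decay_rate ?f l x - decay_rate ?f l y \<le> K * ?d + 3 * \<epsilon>"
      using elim(1,2) by linarith
    also have "\<dots> < c' * ?d"
      using c' d by (simp add: \<epsilon>_def field_simps)
    finally have "(decay_rate ?f l x - decay_rate ?f l y) / ?d < c'"
      using d by (simp add: divide_less_eq)
    moreover have "kappa E w l x y / ereal l \<le> ereal ((decay_rate ?f l x - decay_rate ?f l y) / ?d)"
      by (rule kappa_div_le[OF dist_from_wLip1(1) elim(4) \<open>x \<noteq> y\<close>])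
         (simp add: Dinv_dist_from tight(2))
    ultimately show ?case
      using c'(2) by (meson ereal_less(3) le_less_trans less_trans less_ereal.simps(1))
  qed
qed

lemma lower_le_upper_curvature: "lower_curvature E w x y \<le> upper_curvature E w x y"
  unfolding lower_curvature_def upper_curvature_def by (rule Liminf_le_Limsup) simp

end

section \<open>The diameter bound and its rigidity\<close>

theorem theorem1p1:
  fixes E :: "'v::finite set set" and w :: "'v set \<Rightarrow> real" and K :: real
  assumes "weighted_hypergraph E w"
    and "K > 0"
    and "(INF (x, y)\<in>{(x, y). x \<noteq> y}. lower_curvature E w x y) \<ge> ereal K"
  shows "real (hdiam E) \<le> 2 / K \<and>
    (real (hdiam E) = 2 / K \<longrightarrow>
      (\<exists>p q. hdist E p q = hdiam E \<and>
        (\<forall>v. \<exists>xs. geodesic_between E p q xs \<and> v \<in> set xs) \<and>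
        (\<forall>xs x y. geodesic_between E p q xs \<and> x \<in> set xs \<and> y \<in> set xs \<and> x \<noteq> y \<longrightarrow>
          lower_curvature E w x y = ereal K \<and> upper_curvature E w x y = ereal K)))"
proof -
  interpret weighted_hypergraph E w
    by (fact assms(1))
  have curv: "lower_curvature E w x y \<ge> ereal K" if "x \<noteq> y" for x y
  proof -
    have "(INF (x, y)\<in>{(x, y). x \<noteq> y}. lower_curvature E w x y) \<le> lower_curvature E w x y"
      using that by (intro INF_lower2[of "(x, y)"]) auto
    with assms(3) show ?thesis
      by (rule order_trans)
  qed
  obtain p q where pq: "hdist E p q = hdiam E"
    using hdiam_attained[of E] by blast
  have bound: "real (hdiam E) \<le> 2 / K"
    using curvature_mult_hdist_le_2[OF curv, of p q] \<open>K > 0\<close> pq by (simp add: field_simps)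
  show ?thesis
  proof (intro conjI impI)
    show "real (hdiam E) \<le> 2 / K"
      by (fact bound)
    assume "real (hdiam E) = 2 / K"
    then have extremal: "K * hdist E p q = 2"
      using pq \<open>K > 0\<close> by simp
    have "lower_curvature E w x y = ereal K \<and> upper_curvature E w x y = ereal K"
      if xs: "geodesic_between E p q xs" "x \<in> set xs" "y \<in> set xs" and "x \<noteq> y" for xs x y
    proof -
      have "upper_curvature E w x y \<le> ereal K"
        using geodesic_points_hdist_add[OF xs]
      proof
        assume "hdist E p x + hdist E x y + hdist E y q = hdist E p q"
        then show ?thesis
          by (intro upper_curvature_le_if_extremal[OF curv extremal _ \<open>x \<noteq> y\<close>])
      next
        assume "hdist E p y + hdist E y x + hdist E x q = hdist E p q"
        \<comment> \<open>Read the geodesic backwards, so that it meets \<open>x\<close> before \<open>y\<close>.\<close>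
        then have "hdist E q x + hdist E x y + hdist E y p = hdist E q p"
          by (simp add: hdist_sym)
        moreover have "K * hdist E q p = 2"
          using extremal by (simp add: hdist_sym)
        ultimately show ?thesis
          by (intro upper_curvature_le_if_extremal[OF curv _ _ \<open>x \<noteq> y\<close>])
      qed
      then show ?thesis
        using curv[OF \<open>x \<noteq> y\<close>] lower_le_upper_curvature[of x y] by auto
    qed
    moreover have "\<exists>xs. geodesic_between E p q xs \<and> v \<in> set xs" for v
      by (intro on_geodesic_if_hdist_add hdist_add_eq_if_extremal[OF \<open>K > 0\<close> curv extremal])
    ultimately show "\<exists>p q. hdist E p q = hdiam E \<and>
        (\<forall>v. \<exists>xs. geodesic_between E p q xs \<and> v \<in> set xs) \<and>
        (\<forall>xs x y. geodesic_between E p q xs \<and> x \<in> set xs \<and> y \<in> set xs \<and> x \<noteq> y \<longrightarrow>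
          lower_curvature E w x y = ereal K \<and> upper_curvature E w x y = ereal K)"
      using pq by blast
  qed
qed

end
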